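(* Let $d_X,d_Y,d_Z\ge1$ and $M\in(0,\infty)$, and let $P\in\mathcal E_{0,M}$. Then for any $p\ge1$ and any $\varepsilon>0$ there exists a distribution $Q\in\mathcal P_{0,M}$ such that $$W_p(P,Q)\le\varepsilon.$$
   Context: $\mathcal E_0$ is the set of all distributions of $(X,Y,Z)$ on $\mathbb R^{d_X+d_Y+d_Z}$ that are absolutely continuous with respect to Lebesgue measure. $\mathcal P_0\subset\mathcal E_0$ is the subset of distributions under which $X$ and $Y$ are conditionally independent given $Z$. $\mathcal E_{0,M}\subseteq\mathcal E_0$ is the set of distributions in $\mathcal E_0$ whose support is contained in an $L_\infty$ ball of radius $M$ (i.e. $[-M,M]^{d_X+d_Y+d_Z}$), and $\mathcal P_{0,M}=\mathcal E_{0,M}\cap\mathcal P_0$. For probability measures $\mu,\nu$ on $\mathbb R^d$ with finite $p$-th moments, $W_p(\mu,\nu)=\big(\inf_{\gamma\in\Gamma(\mu,\nu)}\int_{\mathbb R^d\times\mathbb R^d}\|x-y\|_2^p\,d\gamma(x,y)\big)^{1/p}$, where $\Gamma(\mu,\nu)$ is the set of all couplings of $\mu$ and $\nu$. *)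

theory Defs
  imports "HOL-Probability.Probability"
begin

text \<open>
  A distribution of \<open>(X, Y, Z)\<close> is a Borel probability measure on
  \<open>(real^'x) \<times> (real^'y) \<times> (real^'z)\<close>, with \<open>d\<^sub>X = CARD('x)\<close>, \<open>d\<^sub>Y = CARD('y)\<close>, \<open>d\<^sub>Z = CARD('z)\<close>.
  The product norm in the library is the Euclidean norm of the concatenated vector, and
  \<open>lborel\<close> on the product is Lebesgue measure on the concatenated space.
\<close>

text \<open>
  \<open>X\<close> and \<open>Y\<close> are conditionally independent given \<open>Z\<close>: for Borel \<open>A\<close>, \<open>B\<close>, almost surely
  \<open>P(X \<in> A, Y \<in> B | \<sigma>(Z)) = P(X \<in> A | \<sigma>(Z)) P(Y \<in> B | \<sigma>(Z))\<close>.
  This is meant for measurable \<open>X\<close>, \<open>Y\<close>, \<open>Z\<close> on a probability space; \<open>real_cond_exp\<close> is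
  unspecified if \<open>\<sigma>(Z)\<close> is not a sub-sigma-algebra.
\<close>

definition cond_indep ::
  "'w measure \<Rightarrow> ('w \<Rightarrow> 'a::topological_space) \<Rightarrow> ('w \<Rightarrow> 'b::topological_space) \<Rightarrow>
    ('w \<Rightarrow> 'c::topological_space) \<Rightarrow> bool" where
  "cond_indep P X Y Z \<longleftrightarrow>
    (let \<Sigma> = vimage_algebra (space P) Z borel in
      \<forall>A\<in>sets borel. \<forall>B\<in>sets borel. AE w in P.
        real_cond_exp P \<Sigma> (indicator {w \<in> space P. X w \<in> A \<and> Y w \<in> B}) w =
        real_cond_exp P \<Sigma> (indicator {w \<in> space P. X w \<in> A}) w *
        real_cond_exp P \<Sigma> (indicator {w \<in> space P. Y w \<in> B}) w)"

definition measure_support :: "'a::topological_space measure \<Rightarrow> 'a set" where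
  "measure_support P = {x. \<forall>U. open U \<longrightarrow> x \<in> U \<longrightarrow> emeasure P U > 0}"

definition E0 :: "((real^'x::finite) \<times> (real^'y::finite) \<times> (real^'z::finite)) measure set" where
  "E0 = {P. prob_space P \<and> sets P = sets borel \<and> absolutely_continuous lborel P}"

definition P0 :: "((real^'x::finite) \<times> (real^'y::finite) \<times> (real^'z::finite)) measure set" where
  "P0 = {P \<in> E0. cond_indep P (\<lambda>(x, y, z). x) (\<lambda>(x, y, z). y) (\<lambda>(x, y, z). z)}"

definition E0M :: "real \<Rightarrow> ((real^'x::finite) \<times> (real^'y::finite) \<times> (real^'z::finite)) measure set" where
  "E0M M = {P \<in> E0. measure_support P \<subseteq> {w. infnorm w \<le> M}}"

definition P0M :: "real \<Rightarrow> ((real^'x::finite) \<times> (real^'y::finite) \<times> (real^'z::finite)) measure set" where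
  "P0M M = E0M M \<inter> P0"

definition couplings ::
  "'a::euclidean_space measure \<Rightarrow> 'a measure \<Rightarrow> ('a \<times> 'a) measure set" where
  "couplings \<mu> \<nu> = {\<gamma>. prob_space \<gamma> \<and> sets \<gamma> = sets borel \<and>
     distr \<gamma> borel fst = \<mu> \<and> distr \<gamma> borel snd = \<nu>}"

text \<open>
  The transport cost is taken in the extended nonnegative reals, so that an infinite
  infimum gives \<open>W\<^sub>p = \<infinity>\<close>; when the \<open>p\<close>-th moments are finite the first case does not occur.
\<close>

definition Wasserstein ::
  "real \<Rightarrow> 'a::euclidean_space measure \<Rightarrow> 'a measure \<Rightarrow> ennreal" where
  "Wasserstein p \<mu> \<nu> =
    (let c = (INF \<gamma>\<in>couplings \<mu> \<nu>. \<integral>\<^sup>+ (x, y). ennreal (norm (x - y) powr p) \<partial>\<gamma>) in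
      if c = \<infinity> then \<infinity> else ennreal (enn2real c powr (1 / p)))"

end

theory Submission
  imports Defs
begin

text \<open>
  Cover the cube by finitely many small balls with centres in its interior, and perturb the
  centres so that their \<open>Z\<close>-coordinates are pairwise distinct. Move each \<open>w\<close> to a nearby
  centre \<open>T w\<close> and add independent noises \<open>V\<^sub>X, V\<^sub>Y, V\<^sub>Z\<close>, uniform on balls so small that the balls
  around distinct \<open>Z\<close>-coordinates are disjoint. The noise makes the law of \<open>T w + V\<close>
  absolutely continuous; its \<open>Z\<close>-coordinate reveals the whole centre \<open>T w\<close>, so conditionally on it
  only the independent \<open>V\<^sub>X\<close> and \<open>V\<^sub>Y\<close> are left. The pair \<open>(w, T w + V)\<close> is a coupling in which the two
  points never lie far apart.
\<close>

section \<open>Product measures and conditional independence\<close>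

lemma borel_measurable_fst [measurable]:
  "fst \<in> borel_measurable (borel :: ('a::topological_space \<times> 'b::topological_space) measure)"
  by (intro borel_measurable_continuous_onI continuous_intros)

lemma borel_measurable_snd [measurable]:
  "snd \<in> borel_measurable (borel :: ('a::topological_space \<times> 'b::topological_space) measure)"
  by (intro borel_measurable_continuous_onI continuous_intros)

text \<open>On probability spaces the bounds by 1 make every product integrable, so Fubini applies
  twice, first to the last two coordinates.\<close>

lemma integral_prod3_mult:
  fixes f g h :: "_ \<Rightarrow> real"
  assumes M: "prob_space M1" "prob_space M2" "prob_space M3"
    and [measurable]: "f \<in> borel_measurable M1" "g \<in> borel_measurable M2" "h \<in> borel_measurable M3"
    and bound: "\<And>x. \<bar>f x\<bar> \<le> 1" "\<And>x. \<bar>g x\<bar> \<le> 1" "\<And>x. \<bar>h x\<bar> \<le> 1"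
  shows "(\<integral>v. f (fst v) * g (fst (snd v)) * h (snd (snd v)) \<partial>(M1 \<Otimes>\<^sub>M (M2 \<Otimes>\<^sub>M M3)))
    = (\<integral>x. f x \<partial>M1) * (\<integral>x. g x \<partial>M2) * (\<integral>x. h x \<partial>M3)"
proof -
  interpret M1: prob_space M1 by fact
  interpret M2: prob_space M2 by fact
  interpret M3: prob_space M3 by fact
  interpret M23: pair_prob_space M2 M3 ..
  interpret M123: pair_prob_space M1 "M2 \<Otimes>\<^sub>M M3" ..
  have gh: "(\<integral>v. g (fst v) * h (snd v) \<partial>(M2 \<Otimes>\<^sub>M M3)) = (\<integral>x. g x \<partial>M2) * (\<integral>x. h x \<partial>M3)"
    by (subst M23.integral_fst'[symmetric])
      (auto intro!: M23.P.integrable_const_bound[of _ 1] AE_I2 mult_le_one simp: abs_mult bound)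
  show ?thesis
    by (subst M123.integral_fst'[symmetric])
      (auto intro!: M123.P.integrable_const_bound[of _ 1] AE_I2 mult_le_one
        simp: abs_mult bound gh mult.assoc)
qed

lemma absolutely_continuous_pair_measure:
  assumes sf: "sigma_finite_measure M1" "sigma_finite_measure M2" "sigma_finite_measure N1" "sigma_finite_measure N2"
    and ac: "absolutely_continuous M1 N1" "absolutely_continuous M2 N2"
    and sets [measurable_cong]: "sets N1 = sets M1" "sets N2 = sets M2"
  shows "absolutely_continuous (M1 \<Otimes>\<^sub>M M2) (N1 \<Otimes>\<^sub>M N2)"
  unfolding absolutely_continuous_def
proof
  interpret M1: sigma_finite_measure M1 by fact
  interpret M2: sigma_finite_measure M2 by fact
  interpret N1: sigma_finite_measure N1 by fact
  interpret N2: sigma_finite_measure N2 by fact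
  interpret M: pair_sigma_finite M1 M2 ..
  interpret N: pair_sigma_finite N1 N2 ..
  fix A assume A: "A \<in> null_sets (M1 \<Otimes>\<^sub>M M2)"
  then have [measurable]: "A \<in> sets (M1 \<Otimes>\<^sub>M M2)"
    by auto
  have sets_eq: "sets (N1 \<Otimes>\<^sub>M N2) = sets (M1 \<Otimes>\<^sub>M M2)"
    by (intro sets_pair_measure_cong sets)
  have "AE x in M1. AE y in M2. (x, y) \<notin> A"
    using M.AE_pair[OF AE_not_in[OF A]] .
  then have "AE x in N1. AE y in N2. (x, y) \<notin> A"
    by (intro absolutely_continuous_AE[OF sets(1) ac(1)], elim eventually_mono)
      (rule absolutely_continuous_AE[OF sets(2) ac(2)])
  then have "AE u in N1 \<Otimes>\<^sub>M N2. u \<notin> A"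
    by (intro N.AE_pair_measure) (auto simp: sets_eq set_diff_eq[symmetric] sets_eq_imp_space_eq[OF sets_eq])
  then show "A \<in> null_sets (N1 \<Otimes>\<^sub>M N2)"
    by (subst AE_iff_null_sets) (auto simp: sets_eq)
qed

text \<open>\<open>k1 A\<close> and \<open>k2 B\<close> are candidates for the conditional
  probabilities of \<open>X\<close> in \<open>A\<close> and \<open>Y\<close> in \<open>B\<close>,
  written as functions of the value of \<open>Z\<close>. Sets of \<sigma>(Z) are the preimages of
  Borel sets \<open>C\<close>, so \<open>eq\<close> is exactly the property characterizing
  \<open>k1 A * k2 B\<close> as the joint conditional probability.\<close>

lemma cond_indepI_kernel:
  fixes Q :: "('a::euclidean_space \<times> 'b::euclidean_space \<times> 'c::euclidean_space) measure"
    and k1 :: "'a set \<Rightarrow> 'c \<Rightarrow> real" and k2 :: "'b set \<Rightarrow> 'c \<Rightarrow> real"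
  assumes Q: "prob_space Q" and sets_Q: "sets Q = sets borel"
    and k1 [measurable]: "\<And>A. A \<in> sets borel \<Longrightarrow> k1 A \<in> borel_measurable borel"
    and k2 [measurable]: "\<And>B. B \<in> sets borel \<Longrightarrow> k2 B \<in> borel_measurable borel"
    and bound: "\<And>A z. A \<in> sets borel \<Longrightarrow> \<bar>k1 A z\<bar> \<le> 1" "\<And>B z. B \<in> sets borel \<Longrightarrow> \<bar>k2 B z\<bar> \<le> 1"
    and UNIV: "\<And>z. k1 UNIV z = 1" "\<And>z. k2 UNIV z = 1"
    and eq: "\<And>A B C. A \<in> sets borel \<Longrightarrow> B \<in> sets borel \<Longrightarrow> C \<in> sets borel \<Longrightarrow>
      (\<integral>w. indicator A (fst w) * indicator B (fst (snd w)) * indicator C (snd (snd w)) \<partial>Q)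
      = (\<integral>w. k1 A (snd (snd w)) * k2 B (snd (snd w)) * indicator C (snd (snd w)) \<partial>Q)"
  shows "cond_indep Q (\<lambda>(x, y, z). x) (\<lambda>(x, y, z). y) (\<lambda>(x, y, z). z)"
proof -
  interpret prob_space Q by fact
  have space_Q: "space Q = UNIV"
    using sets_eq_imp_space_eq[OF sets_Q] by simp
  have sets_Q' [measurable_cong]: "sets Q = sets (borel \<Otimes>\<^sub>M borel \<Otimes>\<^sub>M borel)"
    by (simp only: sets_Q borel_prod)
  let ?Z = "\<lambda>(x, y, z). z :: 'c"
  define \<Sigma> where "\<Sigma> = vimage_algebra (space Q) ?Z borel"
  have sets_\<Sigma>: "sets \<Sigma> = {?Z -` C | C. C \<in> sets borel}"
    unfolding \<Sigma>_def space_Q by (subst sets_vimage_algebra2) auto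
  have [measurable]: "?Z \<in> measurable Q borel"
    by measurable
  have sub: "subalgebra Q \<Sigma>"
    unfolding subalgebra_def
  proof
    show "space \<Sigma> = space Q"
      by (simp add: \<Sigma>_def)
    show "sets \<Sigma> \<subseteq> sets Q"
      using measurable_sets[of ?Z Q borel] by (auto simp: sets_\<Sigma> space_Q)
  qed
  interpret finite_measure_subalgebra Q \<Sigma>
    by standard (fact sub)
  have Z_meas: "?Z \<in> measurable \<Sigma> borel"
    unfolding \<Sigma>_def by (rule measurable_vimage_algebra1) auto
  have ce: "AE w in Q. real_cond_exp Q \<Sigma> (indicator {w \<in> space Q. fst w \<in> A \<and> fst (snd w) \<in> B}) w
      = k1 A (?Z w) * k2 B (?Z w)"
    if [measurable]: "A \<in> sets borel" "B \<in> sets borel" for A B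
  proof (rule real_cond_exp_charact)
    fix S assume "S \<in> sets \<Sigma>"
    then obtain C where C [measurable]: "C \<in> sets borel" and S: "S = ?Z -` C"
      by (auto simp: sets_\<Sigma>)
    have "(\<integral>w\<in>S. indicator {w \<in> space Q. fst w \<in> A \<and> fst (snd w) \<in> B} w \<partial>Q :: real)
      = (\<integral>w. indicator A (fst w) * indicator B (fst (snd w)) * indicator C (snd (snd w)) \<partial>Q)"
      unfolding set_lebesgue_integral_def
      by (rule Bochner_Integration.integral_cong) (auto simp: S space_Q split: split_indicator)
    also have "\<dots> = (\<integral>w. k1 A (snd (snd w)) * k2 B (snd (snd w)) * indicator C (snd (snd w)) \<partial>Q)"
      by (rule eq) fact+
    also have "\<dots> = (\<integral>w\<in>S. k1 A (?Z w) * k2 B (?Z w) \<partial>Q)"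
      unfolding set_lebesgue_integral_def
      by (rule Bochner_Integration.integral_cong) (auto simp: S split: split_indicator)
    finally show "(\<integral>w\<in>S. indicator {w \<in> space Q. fst w \<in> A \<and> fst (snd w) \<in> B} w \<partial>Q)
      = (\<integral>w\<in>S. k1 A (?Z w) * k2 B (?Z w) \<partial>Q)" .
  next
    show "integrable Q (indicator {w \<in> space Q. fst w \<in> A \<and> fst (snd w) \<in> B} :: _ \<Rightarrow> real)"
      by (rule integrable_const_bound[of _ 1]) (auto split: split_indicator)
    show "integrable Q (\<lambda>w. k1 A (?Z w) * k2 B (?Z w))"
      by (rule integrable_const_bound[of _ 1]) (auto simp: abs_mult bound intro!: mult_le_one)
    show "(\<lambda>w. k1 A (?Z w) * k2 B (?Z w)) \<in> borel_measurable \<Sigma>"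
      using Z_meas by measurable
  qed
  show ?thesis
    unfolding cond_indep_def Let_def \<Sigma>_def[symmetric]
  proof (intro ballI)
    fix A :: "'a set" and B :: "'b set"
    assume A: "A \<in> sets borel" and B: "B \<in> sets borel"
    show "AE w in Q.
      real_cond_exp Q \<Sigma> (indicator {w \<in> space Q. (case w of (x, y, z) \<Rightarrow> x) \<in> A \<and> (case w of (x, y, z) \<Rightarrow> y) \<in> B}) w =
      real_cond_exp Q \<Sigma> (indicator {w \<in> space Q. (case w of (x, y, z) \<Rightarrow> x) \<in> A}) w *
      real_cond_exp Q \<Sigma> (indicator {w \<in> space Q. (case w of (x, y, z) \<Rightarrow> y) \<in> B}) w"
      \<comment> \<open>With \<open>UNIV\<close> for \<open>B\<close> or for \<open>A\<close> the
        other kernel is 1, so the same fact also identifies the two factors on the right.\<close>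
      using ce[OF A B] ce[OF A, of UNIV] ce[OF _ B, of UNIV]
      by (auto simp: UNIV case_prod_unfold)
  qed
qed

section \<open>The law of \<open>T w + v\<close> for independent \<open>w\<close> and
  \<open>v\<close>\<close>

locale random_translation =
  fixes P :: "('a::euclidean_space \<times> 'b::euclidean_space \<times> 'c::euclidean_space) measure"
    and T :: "'a \<times> 'b \<times> 'c \<Rightarrow> 'a \<times> 'b \<times> 'c"
    and \<mu>1 :: "'a measure" and \<mu>2 :: "'b measure" and \<mu>3 :: "'c measure"
  assumes prob: "prob_space P" "prob_space \<mu>1" "prob_space \<mu>2" "prob_space \<mu>3"
    and sets [measurable_cong]: "sets P = sets borel" "sets \<mu>1 = sets borel"
      "sets \<mu>2 = sets borel" "sets \<mu>3 = sets borel"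
    and T [measurable]: "T \<in> borel_measurable borel"
begin

definition "\<mu> = \<mu>1 \<Otimes>\<^sub>M (\<mu>2 \<Otimes>\<^sub>M \<mu>3)"

definition "Q = distr (P \<Otimes>\<^sub>M \<mu>) borel (\<lambda>u. T (fst u) + snd u)"

definition "\<gamma> = distr (P \<Otimes>\<^sub>M \<mu>) borel (\<lambda>u. (fst u, T (fst u) + snd u))"

lemma sets_\<mu> [measurable_cong]: "sets \<mu> = sets borel"
proof -
  have "sets \<mu> = sets (borel \<Otimes>\<^sub>M (borel \<Otimes>\<^sub>M borel))"
    unfolding \<mu>_def by (intro sets_pair_measure_cong sets)
  then show ?thesis by (simp only: borel_prod)
qed

lemma spaces [simp]: "space P = UNIV" "space \<mu> = UNIV" "space \<mu>1 = UNIV" "space \<mu>2 = UNIV" "space \<mu>3 = UNIV"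
  using sets_eq_imp_space_eq[OF sets_\<mu>] sets_eq_imp_space_eq[OF sets(1)] sets_eq_imp_space_eq[OF sets(2)]
    sets_eq_imp_space_eq[OF sets(3)] sets_eq_imp_space_eq[OF sets(4)] by auto

lemma prob_\<mu>: "prob_space \<mu>"
  unfolding \<mu>_def by (intro prob_space_pair prob)

sublocale P: prob_space P by (rule prob)
sublocale \<mu>: prob_space \<mu> by (rule prob_\<mu>)
sublocale P\<mu>: pair_prob_space P \<mu> ..

lemma \<mu>_absolutely_continuous:
  assumes "absolutely_continuous lborel \<mu>1" "absolutely_continuous lborel \<mu>2" "absolutely_continuous lborel \<mu>3"
  shows "absolutely_continuous lborel \<mu>"
  unfolding \<mu>_def lborel_prod[symmetric]
  by (intro absolutely_continuous_pair_measure assms)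
    (auto simp: sets lborel_prod sigma_finite_lborel
      intro!: sets_pair_measure_cong prob_space_imp_sigma_finite prob_space_pair prob)

lemma AE_\<mu>_norm_less:
  assumes "AE x in \<mu>1. norm x < r" "AE y in \<mu>2. norm y < r" "AE z in \<mu>3. norm z < r"
  shows "AE v in \<mu>. norm v < 3 * r"
proof -
  interpret \<mu>1: prob_space \<mu>1 by (rule prob)
  interpret \<mu>2: prob_space \<mu>2 by (rule prob)
  interpret \<mu>3: prob_space \<mu>3 by (rule prob)
  have [measurable_cong]: "sets (\<mu>2 \<Otimes>\<^sub>M \<mu>3) = sets borel"
    by (simp only: sets_pair_measure_cong[OF sets(3,4)] borel_prod)
  have [measurable_cong]: "sets (\<mu>1 \<Otimes>\<^sub>M \<mu>2 \<Otimes>\<^sub>M \<mu>3) = sets borel"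
    using sets_\<mu> unfolding \<mu>_def .
  interpret \<mu>23: pair_prob_space \<mu>2 \<mu>3 ..
  interpret \<mu>123: pair_prob_space \<mu>1 "\<mu>2 \<Otimes>\<^sub>M \<mu>3" ..
  \<comment> \<open>The norm of a triple is bounded crudely by the sum of the three norms; this is
    the origin of the factor 3.\<close>
  have triple: "norm (x, y, z) < 3 * r" if "norm x < r" "norm y < r" "norm z < r" for x :: 'a and y :: 'b and z :: 'c
    using that norm_Pair_le[of x "(y, z)"] norm_Pair_le[of y z] by linarith
  have "AE x in \<mu>1. AE u in \<mu>2 \<Otimes>\<^sub>M \<mu>3. norm (x, u) < 3 * r"
    using assms(1)
  proof eventually_elim
    case (elim x)
    show ?case
    proof (rule \<mu>23.AE_pair_measure)
      show "AE y in \<mu>2. AE z in \<mu>3. norm (x, y, z) < 3 * r"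
        using assms(2)
        by eventually_elim (use assms(3) elim triple in \<open>auto elim: eventually_mono\<close>)
    qed measurable
  qed
  then show ?thesis
    unfolding \<mu>_def by (intro \<mu>123.AE_pair_measure) measurable
qed

lemma Q_prob: "prob_space Q" and sets_Q: "sets Q = sets borel"
  unfolding Q_def by (auto intro!: P\<mu>.prob_space_distr)

lemma \<gamma>_coupling: "\<gamma> \<in> couplings P Q"
proof -
  have \<gamma>: "(\<lambda>u. (fst u, T (fst u) + snd u)) \<in> measurable (P \<Otimes>\<^sub>M \<mu>) borel"
    by measurable
  have "distr \<gamma> borel fst = distr (P \<Otimes>\<^sub>M \<mu>) P fst"
    unfolding \<gamma>_def by (subst distr_distr) (auto intro!: distr_cong \<gamma> simp: sets o_def)
  also have "\<dots> = P"
    by (rule \<mu>.distr_pair_fst)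
  finally have "distr \<gamma> borel fst = P" .
  moreover have "distr \<gamma> borel snd = Q"
    unfolding \<gamma>_def Q_def by (subst distr_distr) (auto intro!: distr_cong \<gamma> simp: o_def)
  ultimately show ?thesis
    unfolding couplings_def by (auto simp: \<gamma>_def intro!: P\<mu>.prob_space_distr \<gamma>)
qed

lemma nn_integral_Q:
  assumes [measurable]: "f \<in> borel_measurable borel"
  shows "(\<integral>\<^sup>+ w. f w \<partial>Q) = (\<integral>\<^sup>+ w. \<integral>\<^sup>+ v. f (T w + v) \<partial>\<mu> \<partial>P)"
  unfolding Q_def by (subst nn_integral_distr) (auto simp: \<mu>.nn_integral_fst[symmetric])

text \<open>\<open>Q\<close> is a mixture, over \<open>w\<close>, of translates of \<mu>, and
  Lebesgue null sets are invariant under translation.\<close>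

lemma Q_absolutely_continuous:
  assumes ac: "absolutely_continuous lborel \<mu>"
  shows "absolutely_continuous lborel Q"
  unfolding absolutely_continuous_def
proof
  fix N :: "('a \<times> 'b \<times> 'c) set"
  assume N: "N \<in> null_sets lborel"
  then have [measurable]: "N \<in> sets borel"
    by auto
  have zero: "(\<integral>\<^sup>+ v. indicator N (T w + v) \<partial>\<mu>) = 0" for w
  proof -
    \<comment> \<open>The sum is written as a difference to match the form of
      \<open>null_sets_translation\<close>.\<close>
    have "{v. v - (- T w) \<in> N} \<in> null_sets \<mu>"
      using null_sets_translation[OF N] ac unfolding absolutely_continuous_def by blast
    then have "{v. T w + v \<in> N} \<in> null_sets \<mu>"
      by (simp add: add.commute)
    moreover have "(\<integral>\<^sup>+ v. indicator N (T w + v) \<partial>\<mu>) = (\<integral>\<^sup>+ v. indicator {v. T w + v \<in> N} v \<partial>\<mu>)"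
      by (intro nn_integral_cong) (auto split: split_indicator)
    ultimately show ?thesis
      by (auto simp: null_sets_def)
  qed
  have "emeasure Q N = (\<integral>\<^sup>+ w. indicator N w \<partial>Q)"
    by (simp add: sets_Q)
  also have "\<dots> = 0"
    by (subst nn_integral_Q) (auto simp: zero)
  finally show "N \<in> null_sets Q"
    by (auto simp: sets_Q)
qed

text \<open>The complement of \<open>K\<close> is an open set of \<open>Q\<close>-measure 0, and as
  a neighbourhood of each of its points it keeps them all out of the support.\<close>

lemma Q_support:
  assumes K: "closed K" and AE: "AE w in P. AE v in \<mu>. T w + v \<in> K"
  shows "measure_support Q \<subseteq> K"
proof -
  have [measurable]: "K \<in> sets borel"
    using K by auto
  have "emeasure Q (- K) = (\<integral>\<^sup>+ w. indicator (- K) w \<partial>Q)"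
    by (simp add: sets_Q)
  also have "\<dots> = (\<integral>\<^sup>+ w. \<integral>\<^sup>+ v. indicator (- K) (T w + v) \<partial>\<mu> \<partial>P)"
    by (subst nn_integral_Q) auto
  also have "\<dots> = (\<integral>\<^sup>+ w. \<integral>\<^sup>+ v. 0 \<partial>\<mu> \<partial>P)"
    using AE
    by (intro nn_integral_cong_AE, elim eventually_mono)
      (intro nn_integral_cong_AE, elim eventually_mono, auto)
  finally have "emeasure Q (- K) = 0"
    by simp
  moreover have "open (- K)"
    using K by (rule open_Compl)
  ultimately show ?thesis
    unfolding measure_support_def by (metis (mono_tags, lifting) ComplI less_irrefl mem_Collect_eq subsetI)
qed

text \<open>The infimum is at most the cost of the single coupling \<gamma>, whose integrand is
  almost everywhere at most \<open>\<epsilon> powr p\<close>.\<close>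

lemma Wasserstein_le:
  assumes p: "p \<ge> 1" and \<epsilon>: "\<epsilon> > 0"
    and AE: "AE w in P. AE v in \<mu>. dist w (T w + v) \<le> \<epsilon>"
  shows "Wasserstein p P Q \<le> ennreal \<epsilon>"
proof -
  define c where "c = (INF \<gamma>\<in>couplings P Q. \<integral>\<^sup>+ (x, y). ennreal (norm (x - y) powr p) \<partial>\<gamma>)"
  have \<gamma>: "(\<lambda>u. (fst u, T (fst u) + snd u)) \<in> measurable (P \<Otimes>\<^sub>M \<mu>) borel"
    by measurable
  have f: "(\<lambda>u. ennreal (norm (fst u - snd u) powr p)) \<in>
      borel_measurable (borel :: (('a \<times> 'b \<times> 'c) \<times> ('a \<times> 'b \<times> 'c)) measure)"
    by measurable
  have f': "(\<lambda>u. ennreal (norm (fst u - (T (fst u) + snd u)) powr p)) \<in> borel_measurable (P \<Otimes>\<^sub>M \<mu>)"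
    using measurable_compose[OF \<gamma> f] by simp
  have "c \<le> (\<integral>\<^sup>+ (x, y). ennreal (norm (x - y) powr p) \<partial>\<gamma>)"
    unfolding c_def by (rule INF_lower[OF \<gamma>_coupling])
  also have "\<dots> = (\<integral>\<^sup>+ u. ennreal (norm (fst u - (T (fst u) + snd u)) powr p) \<partial>(P \<Otimes>\<^sub>M \<mu>))"
    unfolding \<gamma>_def case_prod_unfold by (subst nn_integral_distr[OF \<gamma>]) (use f in auto)
  also have "\<dots> = (\<integral>\<^sup>+ w. \<integral>\<^sup>+ v. ennreal (norm (w - (T w + v)) powr p) \<partial>\<mu> \<partial>P)"
    by (subst \<mu>.nn_integral_fst[OF f', symmetric]) simp
  also have "\<dots> \<le> (\<integral>\<^sup>+ w. \<integral>\<^sup>+ v. ennreal (\<epsilon> powr p) \<partial>\<mu> \<partial>P)"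
    using AE p
    by (intro nn_integral_mono_AE, elim eventually_mono)
      (intro nn_integral_mono_AE, elim eventually_mono,
        auto simp: dist_norm intro!: ennreal_leI powr_mono2)
  also have "\<dots> = ennreal (\<epsilon> powr p)"
    using \<mu>.emeasure_space_1 P.emeasure_space_1 by simp
  finally have c: "c \<le> ennreal (\<epsilon> powr p)" .
  \<comment> \<open>Finiteness selects the real-valued branch in the definition of
    \<open>Wasserstein\<close>.\<close>
  then have "c \<noteq> \<infinity>"
    by (auto simp: top_unique)
  moreover have "enn2real c powr (1 / p) \<le> \<epsilon>"
  proof -
    have "enn2real c \<le> \<epsilon> powr p"
      using c by (intro enn2real_leI) auto
    then have "enn2real c powr (1 / p) \<le> (\<epsilon> powr p) powr (1 / p)"
      using p by (intro powr_mono2) auto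
    then show ?thesis
      using p \<epsilon> by (simp add: powr_powr)
  qed
  ultimately show ?thesis
    unfolding Wasserstein_def Let_def c_def[symmetric] by (auto intro: ennreal_leI)
qed

text \<open>For fixed \<open>w\<close> the three coordinates of \<open>T w + v\<close> are
  independent. Thus \<open>Q\<close> is a mixture of product measures, and the inner integral
  factorizes.\<close>

lemma integral_Q_mult:
  fixes f :: "'a \<Rightarrow> real" and g :: "'b \<Rightarrow> real" and h :: "'c \<Rightarrow> real"
  assumes [measurable]: "f \<in> borel_measurable borel" "g \<in> borel_measurable borel" "h \<in> borel_measurable borel"
    and bound: "\<And>x. \<bar>f x\<bar> \<le> 1" "\<And>x. \<bar>g x\<bar> \<le> 1" "\<And>x. \<bar>h x\<bar> \<le> 1"
  shows "(\<integral>w. f (fst w) * g (fst (snd w)) * h (snd (snd w)) \<partial>Q) =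
    (\<integral>w. (\<integral>x. f (fst (T w) + x) \<partial>\<mu>1) * (\<integral>y. g (fst (snd (T w)) + y) \<partial>\<mu>2)
      * (\<integral>z. h (snd (snd (T w)) + z) \<partial>\<mu>3) \<partial>P)"
proof -
  have m: "(\<lambda>w. f (fst w) * g (fst (snd w)) * h (snd (snd w))) \<in> borel_measurable borel"
    by measurable
  have m': "(\<lambda>u. f (fst (T (fst u) + snd u)) * g (fst (snd (T (fst u) + snd u)))
      * h (snd (snd (T (fst u) + snd u)))) \<in> borel_measurable (P \<Otimes>\<^sub>M \<mu>)"
    by (rule measurable_compose[OF _ m]) measurable
  have "(\<integral>w. f (fst w) * g (fst (snd w)) * h (snd (snd w)) \<partial>Q) =
      (\<integral>u. f (fst (T (fst u) + snd u)) * g (fst (snd (T (fst u) + snd u)))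
      * h (snd (snd (T (fst u) + snd u))) \<partial>(P \<Otimes>\<^sub>M \<mu>))"
    unfolding Q_def by (subst integral_distr[OF _ m]) auto
  also have "\<dots> = (\<integral>w. \<integral>v. f (fst (T w) + fst v) * g (fst (snd (T w)) + fst (snd v))
      * h (snd (snd (T w)) + snd (snd v)) \<partial>\<mu> \<partial>P)"
    by (subst P\<mu>.integral_fst'[symmetric])
      (auto intro!: P\<mu>.P.integrable_const_bound[of _ 1] AE_I2 mult_le_one simp: abs_mult bound m'[simplified])
  also have "\<dots> = (\<integral>w. (\<integral>x. f (fst (T w) + x) \<partial>\<mu>1) * (\<integral>y. g (fst (snd (T w)) + y) \<partial>\<mu>2)
      * (\<integral>z. h (snd (snd (T w)) + z) \<partial>\<mu>3) \<partial>P)"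
    unfolding \<mu>_def
    by (intro Bochner_Integration.integral_cong refl integral_prod3_mult prob bound) measurable
  finally show ?thesis .
qed

text \<open>The functions \<phi> and \<psi> read the \<open>X\<close>- and \<open>Y\<close>-parts of
  the centre \<open>T w\<close> off the noisy \<open>Z\<close>-coordinate. Given that coordinate,
  what remains random in \<open>X\<close> and \<open>Y\<close> is the noise, so the kernels are the
  laws \<mu>1 and \<mu>2 translated by the decoded centre.\<close>

lemma Q_cond_indep:
  fixes \<phi> :: "'c \<Rightarrow> 'a" and \<psi> :: "'c \<Rightarrow> 'b"
  assumes [measurable]: "\<phi> \<in> borel_measurable borel" "\<psi> \<in> borel_measurable borel"
    and decode: "\<And>w. AE z in \<mu>3. \<phi> (snd (snd (T w)) + z) = fst (T w)"
      "\<And>w. AE z in \<mu>3. \<psi> (snd (snd (T w)) + z) = fst (snd (T w))"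
  shows "cond_indep Q (\<lambda>(x, y, z). x) (\<lambda>(x, y, z). y) (\<lambda>(x, y, z). z)"
proof -
  interpret \<mu>1: prob_space \<mu>1 by (rule prob)
  interpret \<mu>2: prob_space \<mu>2 by (rule prob)
  interpret \<mu>3: prob_space \<mu>3 by (rule prob)
  define k1 :: "'a set \<Rightarrow> 'c \<Rightarrow> real" where "k1 A z = (\<integral>x. indicator A (\<phi> z + x) \<partial>\<mu>1)" for A z
  define k2 :: "'b set \<Rightarrow> 'c \<Rightarrow> real" where "k2 B z = (\<integral>y. indicator B (\<psi> z + y) \<partial>\<mu>2)" for B z
  have k1 [measurable]: "k1 A \<in> borel_measurable borel" if [measurable]: "A \<in> sets borel" for A
    unfolding k1_def by measurable
  have k2 [measurable]: "k2 B \<in> borel_measurable borel" if [measurable]: "B \<in> sets borel" for B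
    unfolding k2_def by measurable
  have b1: "\<bar>k1 A z\<bar> \<le> 1" if [measurable]: "A \<in> sets borel" for A z
  proof -
    have "\<bar>k1 A z\<bar> \<le> (\<integral>x. \<bar>indicator A (\<phi> z + x)\<bar> \<partial>\<mu>1)"
      unfolding k1_def by (rule integral_abs_bound)
    also have "\<dots> \<le> 1"
      by (rule \<mu>1.integral_le_const)
        (auto intro!: \<mu>1.integrable_const_bound[of _ 1] split: split_indicator)
    finally show ?thesis .
  qed
  have b2: "\<bar>k2 B z\<bar> \<le> 1" if [measurable]: "B \<in> sets borel" for B z
  proof -
    have "\<bar>k2 B z\<bar> \<le> (\<integral>x. \<bar>indicator B (\<psi> z + x)\<bar> \<partial>\<mu>2)"
      unfolding k2_def by (rule integral_abs_bound)
    also have "\<dots> \<le> 1"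
      by (rule \<mu>2.integral_le_const)
        (auto intro!: \<mu>2.integrable_const_bound[of _ 1] split: split_indicator)
    finally show ?thesis .
  qed
  show ?thesis
  proof (rule cond_indepI_kernel[where ?k1.0 = k1 and ?k2.0 = k2])
    fix A :: "'a set" and B :: "'b set" and C :: "'c set"
    assume [measurable]: "A \<in> sets borel" "B \<in> sets borel" "C \<in> sets borel"
    have "(\<integral>w. k1 A (snd (snd w)) * k2 B (snd (snd w)) * indicator C (snd (snd w)) \<partial>Q)
      = (\<integral>w. \<integral>z. k1 A (snd (snd (T w)) + z) * k2 B (snd (snd (T w)) + z) *
          indicator C (snd (snd (T w)) + z) \<partial>\<mu>3 \<partial>P)"
      \<comment> \<open>The whole integrand depends on the \<open>Z\<close>-coordinate alone and
        takes the role of \<open>h\<close>; the constant factors 1 integrate to 1.\<close>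
      using integral_Q_mult[of "\<lambda>_. 1" "\<lambda>_. 1" "\<lambda>z. k1 A z * k2 B z * indicator C z"] b1 b2
      by (simp add: abs_mult mult_le_one \<mu>1.prob_space[simplified] \<mu>2.prob_space[simplified])
    also have "\<dots> = (\<integral>w. (\<integral>x. indicator A (fst (T w) + x) \<partial>\<mu>1) *
        (\<integral>y. indicator B (fst (snd (T w)) + y) \<partial>\<mu>2) *
        (\<integral>z. indicator C (snd (snd (T w)) + z) \<partial>\<mu>3) \<partial>P)"
    proof (rule Bochner_Integration.integral_cong[OF refl])
      fix w
      \<comment> \<open>Once decoded, both kernels are almost everywhere constant in the noise
        \<open>z\<close> and can be pulled out of the integral.\<close>
      have "(\<integral>z. k1 A (snd (snd (T w)) + z) * k2 B (snd (snd (T w)) + z) *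
          indicator C (snd (snd (T w)) + z) \<partial>\<mu>3) =
        (\<integral>z. (\<integral>x. indicator A (fst (T w) + x) \<partial>\<mu>1) *
        (\<integral>y. indicator B (fst (snd (T w)) + y) \<partial>\<mu>2) *
          indicator C (snd (snd (T w)) + z) \<partial>\<mu>3)"
        using decode[of w] by (intro integral_cong_AE) (auto simp: k1_def k2_def)
      then show "(\<integral>z. k1 A (snd (snd (T w)) + z) * k2 B (snd (snd (T w)) + z) *
          indicator C (snd (snd (T w)) + z) \<partial>\<mu>3) =
        (\<integral>x. indicator A (fst (T w) + x) \<partial>\<mu>1) *
        (\<integral>y. indicator B (fst (snd (T w)) + y) \<partial>\<mu>2) *
        (\<integral>z. indicator C (snd (snd (T w)) + z) \<partial>\<mu>3)"
        by simp
    qed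
    also have "\<dots> = (\<integral>w. indicator A (fst w) * indicator B (fst (snd w)) * indicator C (snd (snd w)) \<partial>Q)"
      by (rule integral_Q_mult[symmetric]) (auto split: split_indicator)
    finally show "(\<integral>w. indicator A (fst w) * indicator B (fst (snd w)) * indicator C (snd (snd w)) \<partial>Q)
      = (\<integral>w. k1 A (snd (snd w)) * k2 B (snd (snd w)) * indicator C (snd (snd w)) \<partial>Q)" by simp
  qed (auto simp: k1_def[of UNIV] k2_def[of UNIV] b1 b2 Q_prob sets_Q
      \<mu>1.prob_space[simplified] \<mu>2.prob_space[simplified])
qed

end

section \<open>Supports, finite quantization and decoding\<close>

lemma compl_measure_support_null_sets:
  fixes P :: "'a::second_countable_topology measure"
  assumes "sets P = sets borel"
  shows "- measure_support P \<in> null_sets P"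
proof -
  define F where "F = {U. open U \<and> emeasure P U = 0}"
  \<comment> \<open>The complement of the support is the union of all open null sets; by the
    Lindelof property countably many of them suffice.\<close>
  obtain F' where F': "F' \<subseteq> F" "countable F'" "\<Union>F' = \<Union>F"
    using Lindelof[of F] unfolding F_def by blast
  have "(\<Union>U\<in>F'. U) \<in> null_sets P"
    using F' assms by (intro null_sets_UN') (auto simp: F_def null_sets_def)
  moreover have "- measure_support P = \<Union>F"
    by (auto simp: measure_support_def F_def)
  ultimately show ?thesis
    using F' by auto
qed

lemma separated_quantizer:
  fixes U :: "('a::euclidean_space \<times> 'b::euclidean_space \<times> 'c::euclidean_space) set"
  assumes S: "finite S" "S \<subseteq> U" and U: "open U" "U \<noteq> {}" and \<delta>: "\<delta> > 0"
  shows "\<exists>T. T \<in> borel_measurable borel \<and> finite (range T) \<and> range T \<subseteq> U \<and>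
    inj_on (\<lambda>t. snd (snd t)) (range T) \<and> (\<forall>w \<in> (\<Union>s\<in>S. ball s \<delta>). dist w (T w) < 2 * \<delta>)"
  using S
proof (induction S rule: finite_induct)
  case empty
  \<comment> \<open>This value remains in use outside all the balls, where no closeness is
    claimed.\<close>
  obtain u where "u \<in> U"
    using U by blast
  then show ?case
    by (intro exI[of _ "\<lambda>_. u"]) auto
next
  case (insert s S)
  then obtain T where T [measurable]: "T \<in> borel_measurable borel" and fin: "finite (range T)"
    and TU: "range T \<subseteq> U" and inj: "inj_on (\<lambda>t. snd (snd t)) (range T)"
    and near: "\<forall>w \<in> (\<Union>s\<in>S. ball s \<delta>). dist w (T w) < 2 * \<delta>"
    by (metis (no_types, lifting) insert_subset)
  obtain a b c where s: "s = (a, b, c)"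
    by (cases s)
  \<comment> \<open>These are the admissible new \<open>Z\<close>-coordinates when the other two
    coordinates of the centre are kept.\<close>
  define V where "V = (\<lambda>z. (a, b, z)) -` (U \<inter> ball s \<delta>)"
  have "open V"
    unfolding V_def using U by (intro open_vimage continuous_intros) auto
  moreover have "c \<in> V"
    using insert.prems \<delta> by (auto simp: V_def s)
  \<comment> \<open>A Euclidean space of positive dimension has no isolated points, so its nonempty
    open sets are infinite and cannot be exhausted by the finitely many \<open>Z\<close>-coordinates
    in use.\<close>
  ultimately have "infinite V"
    using islimpt_UNIV[of c] islimpt_eq_acc_point[of c UNIV] by auto
  then have "infinite (V - (\<lambda>t. snd (snd t)) ` range T)"
    using fin by simp
  then obtain z where z: "z \<in> V" "z \<notin> (\<lambda>t. snd (snd t)) ` range T"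
    by (metis Diff_iff finite.emptyI equals0I)
  define s' where "s' = (a, b, z)"
  have s': "s' \<in> U" "dist s s' < \<delta>"
    using z by (auto simp: s'_def V_def)
  define T' where "T' w = (if w \<in> ball s \<delta> then s' else T w)" for w
  \<comment> \<open>Only an inclusion, since overwriting a ball may remove old values.\<close>
  have range: "range T' \<subseteq> insert s' (range T)"
    by (auto simp: T'_def)
  have "T' \<in> borel_measurable borel"
    unfolding T'_def using open_ball[of s \<delta>] by (intro measurable_If_set) auto
  moreover have "finite (range T')"
    using range fin by (meson finite.insertI finite_subset)
  moreover have "range T' \<subseteq> U"
    using range TU s' by auto
  moreover have "inj_on (\<lambda>t. snd (snd t)) (range T')"
  proof (rule inj_on_subset[OF _ range])
    show "inj_on (\<lambda>t. snd (snd t)) (insert s' (range T))"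
      using inj z by (auto simp: s'_def)
  qed
  moreover have "dist w (T' w) < 2 * \<delta>" if "w \<in> (\<Union>s\<in>insert s S. ball s \<delta>)" for w
  proof (cases "w \<in> ball s \<delta>")
    case True
    then show ?thesis
      using s' dist_triangle[of w s' s] by (simp add: T'_def dist_commute)
  next
    case False
    then show ?thesis
      using that near by (auto simp: T'_def simp del: mem_ball)
  qed
  ultimately show ?case
    by blast
qed

lemma closure_open_infnorm_ball:
  assumes "M > 0" "\<delta> > 0" "infnorm w \<le> M"
  obtains u where "infnorm u < M" "dist u w < \<delta>"
proof
  \<comment> \<open>The point \<open>w\<close> is shrunk towards 0 by the factor
    \<open>1 - t\<close>, which moves it by \<open>t * norm w\<close>. The summand 1 avoids division
    by zero at \<open>w = 0\<close>, and the factor 2 makes the final bound strict.\<close>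
  define t where "t = min 1 (\<delta> / (2 * (norm w + 1)))"
  have pos: "norm w + 1 > 0"
    by (simp add: add_nonneg_pos)
  have t: "0 < t" "t \<le> 1"
    using assms pos by (auto simp: t_def)
  have "(1 - t) * infnorm w \<le> (1 - t) * M"
    using t assms by (intro mult_left_mono) auto
  also have "\<dots> < M"
    using t assms by (simp add: algebra_simps)
  finally show "infnorm ((1 - t) *\<^sub>R w) < M"
    using t by (simp add: infnorm_mul)
  have "dist ((1 - t) *\<^sub>R w) w = t * norm w"
    using t by (simp add: dist_norm algebra_simps)
  also have "\<dots> \<le> t * (norm w + 1)"
    using t by simp
  also have "\<dots> \<le> \<delta> / (2 * (norm w + 1)) * (norm w + 1)"
    using pos by (intro mult_right_mono) (auto simp: t_def)
  also have "\<dots> = \<delta> / 2"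
    using pos by (simp add: field_simps)
  also have "\<dots> < \<delta>"
    using assms by simp
  finally show "dist ((1 - t) *\<^sub>R w) w < \<delta>" .
qed

text \<open>Each of the finitely many requirements holds for all sufficiently small positive
  \<open>r\<close>; the filter \<open>at_right 0\<close> combines them without explicit
  minima.\<close>

lemma finite_uniform_radius:
  fixes F :: "('a::metric_space) set" and G :: "('b::metric_space) set"
  assumes "finite F" "open U" "F \<subseteq> U" "finite G" "\<delta> > 0"
  obtains r :: real where "r > 0" "r \<le> \<delta>" "\<And>s. s \<in> F \<Longrightarrow> ball s r \<subseteq> U"
    "\<And>x y. x \<in> G \<Longrightarrow> y \<in> G \<Longrightarrow> x \<noteq> y \<Longrightarrow> r \<le> dist x y"
proof -
  have *: "eventually (\<lambda>r. r \<le> e) (at_right (0::real))" if "e > 0" for e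
    using that by (auto simp: eventually_at_right intro!: exI[of _ e])
  have "eventually (\<lambda>r. ball s r \<subseteq> U) (at_right (0::real))" if s: "s \<in> F" for s
  proof -
    obtain e where e: "e > 0" "ball s e \<subseteq> U"
      using assms s by (meson open_contains_ball subsetD)
    show ?thesis
      using *[OF e(1)] by eventually_elim (use e in auto)
  qed
  then have "eventually (\<lambda>r. \<forall>s\<in>F. ball s r \<subseteq> U) (at_right (0::real))"
    using assms(1) by (simp add: eventually_ball_finite_distrib)
  moreover have "eventually (\<lambda>r. \<forall>x\<in>G. \<forall>y\<in>G. x \<noteq> y \<longrightarrow> r \<le> dist x y) (at_right (0::real))"
    using assms(4) * by (auto simp: eventually_ball_finite_distrib)
  moreover have "eventually (\<lambda>r. r > 0) (at_right (0::real))"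
    by (rule eventually_at_right_less)
  ultimately have "eventually (\<lambda>r. 0 < r \<and> r \<le> \<delta> \<and> (\<forall>s\<in>F. ball s r \<subseteq> U) \<and>
      (\<forall>x\<in>G. \<forall>y\<in>G. x \<noteq> y \<longrightarrow> r \<le> dist x y)) (at_right (0::real))"
    using *[OF assms(5)] by (intro eventually_conj)
  from eventually_happens'[OF trivial_limit_at_right_real this]
  obtain r where r: "0 < r" "r \<le> \<delta>" "\<forall>s\<in>F. ball s r \<subseteq> U"
      "\<forall>x\<in>G. \<forall>y\<in>G. x \<noteq> y \<longrightarrow> r \<le> dist x y"
    by (elim exE conjE)
  show ?thesis
    by (rule that[OF r(1,2)]) (simp_all only: r(3,4) bspec[OF r(3)] bspec[OF bspec[OF r(4)]] simp_thms)
qed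

lemma separated_decoder:
  fixes F :: "'a set" and \<pi> :: "'a \<Rightarrow> 'c::euclidean_space" and f :: "'a \<Rightarrow> 'b::euclidean_space"
  assumes fin: "finite F" and sep: "\<forall>s\<in>F. \<forall>t\<in>F. s \<noteq> t \<longrightarrow> 2 * r \<le> dist (\<pi> s) (\<pi> t)"
  shows "\<exists>\<phi>\<in>borel_measurable borel. \<forall>s\<in>F. \<forall>z. norm z < r \<longrightarrow> \<phi> (\<pi> s + z) = f s"
\<comment> \<open>The balls of radius \<open>r\<close> around the points \<open>\<pi> s\<close> are
  disjoint by the separation \<open>2 * r\<close>, so at a point of one of them only the matching
  summand survives. Off all the balls the decoder is 0.\<close>
proof (intro bexI[where x = "\<lambda>z. (\<Sum>s\<in>F. indicator (ball (\<pi> s) r) z *\<^sub>R f s)"] ballI allI impI)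
  fix s and z :: 'c assume s: "s \<in> F" and z: "norm z < r"
  have "indicator (ball (\<pi> t) r) (\<pi> s + z) *\<^sub>R f t = (if t = s then f s else 0)" if t: "t \<in> F" for t
  proof (cases "t = s")
    case True
    then show ?thesis
      using z by (simp add: dist_norm)
  next
    case False
    have "2 * r \<le> dist (\<pi> t) (\<pi> s)"
      using sep s t False by blast
    also have "\<dots> \<le> dist (\<pi> t) (\<pi> s + z) + norm z"
      using dist_triangle[of "\<pi> t" "\<pi> s" "\<pi> s + z"] by (simp add: dist_norm)
    finally have "\<pi> s + z \<notin> ball (\<pi> t) r"
      using z by simp
    then show ?thesis
      using False by simp
  qed
  then have "(\<Sum>t\<in>F. indicator (ball (\<pi> t) r) (\<pi> s + z) *\<^sub>R f t) = (\<Sum>t\<in>F. if t = s then f s else 0)"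
    by (intro sum.cong) auto
  then show "(\<Sum>t\<in>F. indicator (ball (\<pi> t) r) (\<pi> s + z) *\<^sub>R f t) = f s"
    using fin s by simp
next
  show "(\<lambda>z. \<Sum>s\<in>F. indicator (ball (\<pi> s) r) z *\<^sub>R f s) \<in> borel_measurable borel"
    by (intro borel_measurable_sum borel_measurable_scaleR borel_measurable_indicator borel_measurable_const) auto
qed

section \<open>Uniform noise and the choice of parameters\<close>

lemma uniform_ball_prob_space:
  assumes "r > 0"
  shows "prob_space (uniform_measure lborel (ball (0::'a::euclidean_space) r))"
  using assms content_ball_pos[of r "0::'a"] emeasure_bounded_finite[of "ball (0::'a) r"]
  by (intro prob_space_uniform_measure) (auto simp: measure_def enn2real_positive_iff)

theorem lemma3p2:
  fixes P :: "((real^'x::finite) \<times> (real^'y::finite) \<times> (real^'z::finite)) measure"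
    and M p \<epsilon> :: real
  assumes "M > 0" and "P \<in> E0M M" and "p \<ge> 1" and "\<epsilon> > 0"
  shows "\<exists>Q \<in> P0M M. Wasserstein p P Q \<le> ennreal \<epsilon>"
proof -
  define U K where "U = {w :: (real^'x) \<times> (real^'y) \<times> (real^'z). infnorm w < M}"
    and "K = {w :: (real^'x) \<times> (real^'y) \<times> (real^'z). infnorm w \<le> M}"
  have P: "prob_space P" "sets P = sets borel" "measure_support P \<subseteq> K"
    using assms(2) by (auto simp: E0M_def E0_def K_def)
  have U: "open U" "0 \<in> U"
    unfolding U_def using assms(1)
    by (auto intro!: open_Collect_less continuous_intros simp: infnorm_0)
  have K: "closed K" "U \<subseteq> K"
    by (auto simp: K_def U_def intro!: closed_Collect_le continuous_intros)
  have "bounded K"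
    unfolding bounded_iff K_def
    by (rule exI[of _ "sqrt DIM((real^'x) \<times> (real^'y) \<times> (real^'z)) * M"])
      (auto intro!: order_trans[OF norm_le_infnorm] mult_left_mono)
  then have "compact K"
    using K by (simp add: compact_eq_bounded_closed)
  have AE_K: "AE w in P. w \<in> K"
    using AE_not_in[OF compl_measure_support_null_sets[OF P(2)]] by eventually_elim (use P(3) in auto)
  \<comment> \<open>Two thirds of \<epsilon> are spent on the quantizer and one third on the
    noise.\<close>
  define \<delta> where "\<delta> = \<epsilon> / 3"
  have \<delta>: "\<delta> > 0"
    using assms by (simp add: \<delta>_def)
  \<comment> \<open>Centres in the open cube leave room for noise that does not leave the closed
    cube.\<close>
  have "K \<subseteq> (\<Union>u\<in>U. ball u \<delta>)"
    using closure_open_infnorm_ball[OF assms(1) \<delta>] by (fastforce simp: K_def U_def)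
  then obtain S where S: "S \<subseteq> U" "finite S" "K \<subseteq> (\<Union>u\<in>S. ball u \<delta>)"
    using compactE_image[OF \<open>compact K\<close>, of U "\<lambda>u. ball u \<delta>"] by auto
  obtain T where T: "T \<in> borel_measurable borel" "finite (range T)" "range T \<subseteq> U"
      "inj_on (\<lambda>t. snd (snd t)) (range T)" and near: "\<And>w. w \<in> K \<Longrightarrow> dist w (T w) < 2 * \<delta>"
    using separated_quantizer[OF S(2,1) U(1) _ \<delta>] U(2) S(3) by blast
  obtain \<rho> where \<rho>: "\<rho> > 0" "\<rho> \<le> \<delta>" and sub: "\<And>s. s \<in> range T \<Longrightarrow> ball s \<rho> \<subseteq> U"
    and sep: "\<And>x y. x \<in> (\<lambda>t. snd (snd t)) ` range T \<Longrightarrow> y \<in> (\<lambda>t. snd (snd t)) ` range T \<Longrightarrow>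
      x \<noteq> y \<Longrightarrow> \<rho> \<le> dist x y"
    using finite_uniform_radius[OF T(2) U(1) T(3) finite_imageI[OF T(2)] \<delta>] by metis
  \<comment> \<open>Three noise components of norm below \<open>r\<close> have joint norm below
    \<rho>, and \<open>2 * r\<close> stays below the separation \<rho> of the
    \<open>Z\<close>-coordinates.\<close>
  define r where "r = \<rho> / 3"
  have r: "r > 0"
    using \<rho> by (simp add: r_def)
  have sep': "\<forall>s\<in>range T. \<forall>t\<in>range T. s \<noteq> t \<longrightarrow> 2 * r \<le> dist (snd (snd s)) (snd (snd t))"
  proof (intro ballI impI)
    fix s t assume "s \<in> range T" "t \<in> range T" "s \<noteq> t"
    \<comment> \<open>Distinct centres have distinct \<open>Z\<close>-coordinates by injectivity, so
      the separation of coordinates becomes one indexed by centres.\<close>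
    then have "\<rho> \<le> dist (snd (snd s)) (snd (snd t))"
      by (intro sep imageI) (auto dest: inj_onD[OF T(4)])
    then show "2 * r \<le> dist (snd (snd s)) (snd (snd t))"
      using \<rho> by (simp add: r_def)
  qed
  obtain \<phi> where \<phi>: "\<phi> \<in> borel_measurable borel"
    "\<forall>s\<in>range T. \<forall>z. norm z < r \<longrightarrow> \<phi> (snd (snd s) + z) = fst s"
    using separated_decoder[where \<pi> = "\<lambda>s. snd (snd s)" and f = fst, OF T(2) sep']
    by (elim bexE)
  obtain \<psi> where \<psi>: "\<psi> \<in> borel_measurable borel"
    "\<forall>s\<in>range T. \<forall>z. norm z < r \<longrightarrow> \<psi> (snd (snd s) + z) = fst (snd s)"
    using separated_decoder[where \<pi> = "\<lambda>s. snd (snd s)" and f = "\<lambda>s. fst (snd s)", OF T(2) sep']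
    by (elim bexE)
  interpret random_translation P T "uniform_measure lborel (ball 0 r)"
    "uniform_measure lborel (ball 0 r)" "uniform_measure lborel (ball 0 r)"
    by (intro random_translation.intro) (simp_all only: P T uniform_ball_prob_space[OF r] sets_uniform_measure sets_lborel)
  have ball_AE: "AE x in uniform_measure lborel (ball (0::'a::euclidean_space) r). norm x < r"
    by (rule AE_uniform_measureI) auto
  have AE_\<mu>: "AE v in \<mu>. norm v < \<rho>"
    using AE_\<mu>_norm_less[OF ball_AE ball_AE ball_AE] by (simp add: r_def)
  have in_K: "AE w in P. AE v in \<mu>. T w + v \<in> K"
  proof (rule AE_I2)
    fix w
    show "AE v in \<mu>. T w + v \<in> K"
      using AE_\<mu>
    proof eventually_elim
      case (elim v)
      then have "T w + v \<in> ball (T w) \<rho>"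
        by (simp add: dist_norm)
      then show ?case
        using sub K by blast
    qed
  qed
  \<comment> \<open>The quantizer is controlled on \<open>K\<close> only, so this estimate, unlike
    \<open>in_K\<close>, uses that \<open>P\<close> is concentrated on \<open>K\<close>.\<close>
  have close: "AE w in P. AE v in \<mu>. dist w (T w + v) \<le> \<epsilon>"
    using AE_K
  proof eventually_elim
    case (elim w)
    show ?case
      using AE_\<mu>
    proof eventually_elim
      case (elim v)
      have "dist w (T w + v) \<le> dist w (T w) + norm v"
        using dist_triangle[of w "T w + v" "T w"] by (simp add: dist_norm)
      then show ?case
        using near[OF \<open>w \<in> K\<close>] elim \<rho> by (simp add: \<delta>_def)
    qed
  qed
  have ac: "absolutely_continuous lborel (uniform_measure lborel (ball (0::'a::euclidean_space) r))"
    unfolding uniform_measure_def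
    by (intro absolutely_continuousI_density borel_measurable_divide_ennreal borel_measurable_indicator
        borel_measurable_const) auto
  have "Q \<in> E0"
    unfolding E0_def using Q_prob sets_Q Q_absolutely_continuous[OF \<mu>_absolutely_continuous[OF ac ac ac]] by simp
  moreover have "measure_support Q \<subseteq> K"
    using Q_support[OF K(1) in_K] .
  moreover have "cond_indep Q (\<lambda>(x, y, z). x) (\<lambda>(x, y, z). y) (\<lambda>(x, y, z). z)"
  proof (rule Q_cond_indep[OF \<phi>(1) \<psi>(1)])
    fix w
    show "AE z in uniform_measure lborel (ball 0 r). \<phi> (snd (snd (T w)) + z) = fst (T w)"
      using ball_AE by eventually_elim (simp add: \<phi>)
    show "AE z in uniform_measure lborel (ball 0 r). \<psi> (snd (snd (T w)) + z) = fst (snd (T w))"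
      using ball_AE by eventually_elim (simp add: \<psi>)
  qed
  ultimately have "Q \<in> P0M M"
    by (auto simp: P0M_def P0_def E0M_def K_def)
  with Wasserstein_le[OF assms(3,4) close] show ?thesis
    by (rule rev_bexI[rotated])
qed

end
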